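(* Let $G$ be a strongly SC-bounded cost-minimization game, and suppose that the robust price of anarchy of the corresponding social contribution game $\bar G$ is $\xi$. Then for all friendship extensions $G^\alpha$ of $G$ (with $\alpha\in[0,1]^{N\times N}$, $\alpha_{ii}=1$ for all $i$), the robust price of anarchy of $G^\alpha$ is at most $\xi$.
   Context: A cost-minimization game $G=(N,\{\Sigma_i\}_{i\in N},\{C_i\}_{i\in N})$ has a finite player set $N$, strategy sets $\Sigma_i$, profiles $\Sigma=\prod_i\Sigma_i$, and cost functions $C_i:\Sigma\to\mathbb R$; it comes with a social cost $C:\Sigma\to\mathbb R$. $(t_i,s_{-i})$ denotes $s$ with player $i$'s strategy replaced by $t_i$. $C$ is weight-bounded if $C\le\sum_iw_iC_i$ (pointwise) for some $w\in\mathbb R_+^N$. Each player $i$ has a default strategy $\emptyset_i$ ("not participating"), which need not belong to $\Sigma_i$; $C$ and all $C_j$ are understood to be extended to real-valued functions on $\prod_{i\in N}(\Sigma_i\cup\{\emptyset_i\})$. A game $G$ with weight-bounded social cost (with weights $w$) is strongly SC-bounded if for all $s\in\Sigma$ and all players $i$: (1) $C_i(\emptyset_i,s_{-i})=0$; (2) $C_j(\emptyset_i,s_{-i})\le C_j(s)$ for all $j\ne i$; (3) $w_i\sum_{j\in N}(C_j(s)-C_j(\emptyset_i,s_{-i}))\le C(s)-C(\emptyset_i,s_{-i})$. The corresponding social contribution game is $\bar G=(N,\{\Sigma_i\},\{\bar C_i\})$ with $\bar C_i(s)=C(s)-C(\emptyset_i,s_{-i})$ and the same social cost $C$. $\bar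 G$ is $(\lambda,\mu)$-smooth if there exist $\bar s\in\Sigma$ and an optimal $s^*\in\Sigma$ (a minimizer of $C$) such that for all $s\in\Sigma$, $\sum_i\bar C_i(\bar s_i,s_{-i})\le\lambda C(s^* )+\mu C(s)$. Friendship extension: for $\alpha\in[0,1]^{N\times N}$ with $\alpha_{ii}=1$ for all $i$, $G^\alpha=(N,\{\Sigma_i\},\{C_i^\alpha\})$ with $C_i^\alpha=\sum_{j\in N}\alpha_{ij}C_j$; its social cost is again $C$. $G^\alpha$ is $(\lambda,\mu)$-smooth if there is a (possibly randomized) profile $\bar s$ such that for all $s\in\Sigma$ and all optima $s^*$, $$\sum_iw_i\Big(C_i(\bar s_i,s_{-i})+\sum_{j\ne i}\alpha_{ij}\big(C_j(\bar s_i,s_{-i})-C_j(s)\big)\Big)\le\lambda C(s^* )+\mu C(s)$$ (left-hand side in expectation over $\bar s$ if $\bar s$ is randomized). For $H=\bar G$ or $H=G^\alpha$, the robust price of anarchy of $H$ is $\inf\{\frac{\lambda}{1-\mu} : H\text{ is }(\lambda,\mu)\text{-smooth},\ \mu<1\}$, with the respective notion of smoothness. *)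

theory Defs
  imports "HOL-Probability.Probability"
begin

text \<open>Cost functions are total on the function type, so they also have values at profiles in
  which players use strategies outside their strategy sets, in particular default strategies.\<close>

record ('i, 's) game =
  players :: "'i set"
  strategies :: "'i \<Rightarrow> 's set"
  cost :: "'i \<Rightarrow> ('i \<Rightarrow> 's) \<Rightarrow> real"
  social_cost :: "('i \<Rightarrow> 's) \<Rightarrow> real"

definition profiles :: "('i, 's) game \<Rightarrow> ('i \<Rightarrow> 's) set" where
  "profiles G = (\<Pi>\<^sub>E i\<in>players G. strategies G i)"

definition optimal :: "('i, 's) game \<Rightarrow> ('i \<Rightarrow> 's) \<Rightarrow> bool" where
  "optimal G s \<longleftrightarrow> s \<in> profiles G \<and> (\<forall>t\<in>profiles G. social_cost G s \<le> social_cost G t)"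

definition weight_bounded :: "('i, 's) game \<Rightarrow> ('i \<Rightarrow> real) \<Rightarrow> bool" where
  "weight_bounded G w \<longleftrightarrow>
     (\<forall>i\<in>players G. 0 \<le> w i) \<and>
     (\<forall>s\<in>profiles G. social_cost G s \<le> (\<Sum>i\<in>players G. w i * cost G i s))"

text \<open>The default strategy \<open>d i\<close> of player \<open>i\<close> may or may not belong to \<open>strategies G i\<close>.\<close>

definition strongly_SC_bounded :: "('i, 's) game \<Rightarrow> ('i \<Rightarrow> 's) \<Rightarrow> ('i \<Rightarrow> real) \<Rightarrow> bool" where
  "strongly_SC_bounded G d w \<longleftrightarrow>
     weight_bounded G w \<and>
     (\<forall>s\<in>profiles G. \<forall>i\<in>players G.
        cost G i (s(i := d i)) = 0 \<and>
        (\<forall>j\<in>players G - {i}. cost G j (s(i := d i)) \<le> cost G j s) \<and>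
        w i * (\<Sum>j\<in>players G. cost G j s - cost G j (s(i := d i)))
          \<le> social_cost G s - social_cost G (s(i := d i)))"

definition social_contribution_game :: "('i, 's) game \<Rightarrow> ('i \<Rightarrow> 's) \<Rightarrow> ('i, 's) game" where
  "social_contribution_game G d =
     G\<lparr>cost := (\<lambda>i s. social_cost G s - social_cost G (s(i := d i)))\<rparr>"

definition smooth_game :: "('i, 's) game \<Rightarrow> real \<Rightarrow> real \<Rightarrow> bool" where
  "smooth_game H l m \<longleftrightarrow>
     (\<exists>t\<in>profiles H. \<exists>opt. optimal H opt \<and>
        (\<forall>s\<in>profiles H.
           (\<Sum>i\<in>players H. cost H i (s(i := t i))) \<le> l * social_cost H opt + m * social_cost H s))"

definition friendship_matrix :: "'i set \<Rightarrow> ('i \<Rightarrow> 'i \<Rightarrow> real) \<Rightarrow> bool" where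
  "friendship_matrix N a \<longleftrightarrow> (\<forall>i\<in>N. \<forall>j\<in>N. a i j \<in> {0..1}) \<and> (\<forall>i\<in>N. a i i = 1)"

definition friendship_extension :: "('i, 's) game \<Rightarrow> ('i \<Rightarrow> 'i \<Rightarrow> real) \<Rightarrow> ('i, 's) game" where
  "friendship_extension G a = G\<lparr>cost := (\<lambda>i s. \<Sum>j\<in>players G. a i j * cost G j s)\<rparr>"

definition deviation_cost ::
    "('i, 's) game \<Rightarrow> ('i \<Rightarrow> real) \<Rightarrow> ('i \<Rightarrow> 'i \<Rightarrow> real) \<Rightarrow> ('i \<Rightarrow> 's) \<Rightarrow> ('i \<Rightarrow> 's) \<Rightarrow> real" where
  "deviation_cost G w a t s =
     (\<Sum>i\<in>players G. w i *
        (cost G i (s(i := t i)) +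
         (\<Sum>j\<in>players G - {i}. a i j * (cost G j (s(i := t i)) - cost G j s))))"

text \<open>Smoothness of a friendship extension depends on the costs of the underlying game \<open>G\<close> and on
  its weights, not only on the game \<open>friendship_extension G a\<close>. The randomized profile is a
  probability measure on the set of profiles (with any sigma-algebra); point masses give the
  deterministic profiles. Integrability is required because the Bochner integral of a
  non-integrable function is 0. Each term of the integrand depends on a single
  coordinate of the random profile, so no independence across players is imposed.\<close>

definition smooth_friendship ::
    "('i, 's) game \<Rightarrow> ('i \<Rightarrow> real) \<Rightarrow> ('i \<Rightarrow> 'i \<Rightarrow> real) \<Rightarrow> real \<Rightarrow> real \<Rightarrow> bool" where
  "smooth_friendship G w a l m \<longleftrightarrow>
     (let H = friendship_extension G a in
      \<exists>M. prob_space M \<and> space M = profiles H \<and>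
        (\<forall>s\<in>profiles H.
           integrable M (\<lambda>t. deviation_cost G w a t s) \<and>
           (\<forall>opt. optimal H opt \<longrightarrow>
              (\<integral>t. deviation_cost G w a t s \<partial>M)
                \<le> l * social_cost H opt + m * social_cost H s)))"

text \<open>The infimum is taken in the extended reals, so it is \<open>\<infinity>\<close> if there are no smoothness
  parameters.\<close>

definition robust_poa :: "(real \<Rightarrow> real \<Rightarrow> bool) \<Rightarrow> ereal" where
  "robust_poa smooth = Inf {ereal (l / (1 - m)) | l m. smooth l m \<and> m < 1}"

end

theory Submission imports Defs begin

text \<open>Let \<open>s\<close> be a profile in which player \<open>i\<close> deviates to \<open>t i\<close>, giving \<open>s'\<close>. Both \<open>s\<close> and \<open>s'\<close> turn
  into the same profile \<open>r\<close> when \<open>i\<close> switches to the default strategy. Since the cost of every other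
  player \<open>j\<close> at \<open>r\<close> is at most that at \<open>s\<close> and at most that at \<open>s'\<close>, we have
  \<open>a i j * (C\<^sub>j s' - C\<^sub>j s) \<le> C\<^sub>j s' - C\<^sub>j r\<close>. Hence the contribution of \<open>i\<close> to the smoothness condition
  of the friendship extension is at most \<open>w i * (\<Sum>j. C\<^sub>j s' - C\<^sub>j r)\<close>, which strong SC-boundedness
  bounds by the cost of \<open>i\<close> in the social contribution game. So every pair of smoothness parameters
  of the latter game is one of the friendship extension.\<close>

lemma profiles_upd:
  assumes "s \<in> profiles G" "t \<in> profiles G" "i \<in> players G"
  shows "s(i := t i) \<in> profiles G"
  using assms unfolding profiles_def by (auto simp: PiE_iff extensional_def)

lemma optimal_social_cost_unique:
  assumes "optimal G s" "optimal G t"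
  shows "social_cost G s = social_cost G t"
  using assms by (simp add: optimal_def order_antisym)

lemma deviation_cost_le_social_contribution:
  assumes fin: "finite (players G)"
    and G: "strongly_SC_bounded G d w"
    and a: "friendship_matrix (players G) a"
    and s: "s \<in> profiles G" and t: "t \<in> profiles G"
  shows "deviation_cost G w a t s
    \<le> (\<Sum>i\<in>players G. cost (social_contribution_game G d) i (s(i := t i)))"
  unfolding deviation_cost_def
proof (rule sum_mono)
  fix i assume i: "i \<in> players G"
  define s' where "s' = s(i := t i)"
  define r where "r = s(i := d i)"
  have s': "s' \<in> profiles G" and r: "s'(i := d i) = r"
    using profiles_upd[OF s t i] by (simp_all add: s'_def r_def)
  have w: "0 \<le> w i"
    using G i by (simp add: strongly_SC_bounded_def weight_bounded_def)
  have zero: "cost G i r = 0"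
    and mono: "\<And>j. j \<in> players G - {i} \<Longrightarrow> cost G j r \<le> cost G j s"
    using G s i unfolding strongly_SC_bounded_def r_def by blast+
  \<comment> \<open>Strong SC-boundedness is now used at \<open>s'\<close>, whose default profile
    for \<open>i\<close> is again \<open>r\<close>; condition (3) is needed only here, not at
    \<open>s\<close>.\<close>
  have mono': "\<And>j. j \<in> players G - {i} \<Longrightarrow> cost G j r \<le> cost G j s'"
    and sc: "w i * (\<Sum>j\<in>players G. cost G j s' - cost G j r) \<le> social_cost G s' - social_cost G r"
    using G s' i unfolding strongly_SC_bounded_def r[symmetric] by blast+
  have "a i j * (cost G j s' - cost G j s) \<le> cost G j s' - cost G j r"
    if j: "j \<in> players G - {i}" for j
  proof -
    have "0 \<le> a i j" "a i j \<le> 1"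
      using a i j by (auto simp: friendship_matrix_def)
    \<comment> \<open>Lowering \<open>cost G j s\<close> to \<open>cost G j r\<close> uses
      \<open>0 \<le> a i j\<close>. It makes the difference nonnegative, so that the factor
      \<open>a i j \<le> 1\<close> can then be dropped.\<close>
    then have "a i j * (cost G j s' - cost G j s) \<le> a i j * (cost G j s' - cost G j r)"
      using mono[OF j] by (intro mult_left_mono) auto
    also have "\<dots> \<le> cost G j s' - cost G j r"
      using mono'[OF j] \<open>a i j \<le> 1\<close> by (intro mult_left_le_one_le) (use \<open>0 \<le> a i j\<close> in auto)
    finally show ?thesis .
  qed
  then have "(\<Sum>j\<in>players G - {i}. a i j * (cost G j s' - cost G j s))
      \<le> (\<Sum>j\<in>players G - {i}. cost G j s' - cost G j r)"
    by (rule sum_mono)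
  \<comment> \<open>As \<open>cost G i r = 0\<close>, the term \<open>cost G i s'\<close> is exactly
    the missing summand \<open>j = i\<close> on the right.\<close>
  then have "cost G i s' + (\<Sum>j\<in>players G - {i}. a i j * (cost G j s' - cost G j s))
      \<le> (\<Sum>j\<in>players G. cost G j s' - cost G j r)"
    using zero by (simp add: sum.remove[OF fin i])
  from mult_left_mono[OF this w] sc
  show "w i * (cost G i (s(i := t i)) +
      (\<Sum>j\<in>players G - {i}. a i j * (cost G j (s(i := t i)) - cost G j s)))
    \<le> cost (social_contribution_game G d) i (s(i := t i))"
    unfolding social_contribution_game_def by (simp add: s'_def r_def)
qed

lemma smooth_friendshipI:
  assumes t: "t \<in> profiles G"
    and bound: "\<And>s opt. s \<in> profiles G \<Longrightarrow> optimal G opt \<Longrightarrow>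
      deviation_cost G w a t s \<le> l * social_cost G opt + m * social_cost G s"
  shows "smooth_friendship G w a l m"
proof -
  \<comment> \<open>The point mass at \<open>t\<close> on the discrete sigma-algebra: every function
    is measurable, and its integral is its value at \<open>t\<close>.\<close>
  define M where "M = return (count_space (profiles G)) t"
  have prob: "prob_space M"
    unfolding M_def using t by (intro prob_space_return) simp
  have "integrable M (\<lambda>u. deviation_cost G w a u s)"
    "(\<integral>u. deviation_cost G w a u s \<partial>M) = deviation_cost G w a t s" for s
    unfolding M_def using t by (simp_all add: integrable_iff_bounded nn_integral_return integral_return)
  moreover have "profiles (friendship_extension G a) = profiles G"
    "optimal (friendship_extension G a) = optimal G"
    by (auto simp: profiles_def optimal_def friendship_extension_def fun_eq_iff)
  ultimately show ?thesis
    unfolding smooth_friendship_def Let_def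
    using bound prob by (intro exI[of _ M]) (auto simp: M_def friendship_extension_def)
qed

lemma smooth_friendship_if_smooth_social_contribution:
  assumes "finite (players G)" "strongly_SC_bounded G d w" "friendship_matrix (players G) a"
    and smooth: "smooth_game (social_contribution_game G d) l m"
  shows "smooth_friendship G w a l m"
proof -
  have eqs: "players (social_contribution_game G d) = players G"
    "profiles (social_contribution_game G d) = profiles G"
    "optimal (social_contribution_game G d) = optimal G"
    "social_cost (social_contribution_game G d) = social_cost G"
    by (auto simp: profiles_def optimal_def social_contribution_game_def fun_eq_iff)
  obtain t opt where t: "t \<in> profiles G" and opt: "optimal G opt"
    and bound: "\<And>s. s \<in> profiles G \<Longrightarrow>
      (\<Sum>i\<in>players G. cost (social_contribution_game G d) i (s(i := t i)))
        \<le> l * social_cost G opt + m * social_cost G s"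
    using smooth unfolding smooth_game_def eqs by blast
  show ?thesis
  proof (rule smooth_friendshipI[OF t])
    fix s opt' assume s: "s \<in> profiles G" and "optimal G opt'"
    \<comment> \<open>Smoothness of the social contribution game supplies a single optimum, while
      the friendship extension asks for all of them; the bound transfers because optima share their
      social cost.\<close>
    with opt have "social_cost G opt' = social_cost G opt"
      by (intro optimal_social_cost_unique)
    with deviation_cost_le_social_contribution[OF assms(1-3) s t] bound[OF s]
    show "deviation_cost G w a t s \<le> l * social_cost G opt' + m * social_cost G s"
      by simp
  qed
qed

lemma robust_poa_mono:
  assumes "\<And>l m. P l m \<Longrightarrow> Q l m"
  shows "robust_poa Q \<le> robust_poa P"
  unfolding robust_poa_def using assms by (intro Inf_superset_mono) blast

theorem theorem4:
  fixes G :: "('i, 's) game"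
    and d :: "'i \<Rightarrow> 's"
    and w :: "'i \<Rightarrow> real"
    and \<xi> :: ereal
  assumes "finite (players G)"
    and "strongly_SC_bounded G d w"
    and "robust_poa (smooth_game (social_contribution_game G d)) = \<xi>"
  shows "\<forall>a. friendship_matrix (players G) a \<longrightarrow> robust_poa (smooth_friendship G w a) \<le> \<xi>"
  using assms(3) robust_poa_mono smooth_friendship_if_smooth_social_contribution[OF assms(1,2)]
  by blast

end
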